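(* Let $A$ be a positive self-adjoint Hopf (PSH) algebra. Then the map $$\varphi:A\otimes A\to\mathrm{End}_{\mathbb Z}(A),\qquad \varphi(x\otimes y)=m_x\Delta_y,$$ is injective and its image is a subalgebra of $\mathrm{End}_{\mathbb Z}(A)$.
   Context: A PSH algebra is a graded connected Hopf algebra $A=\bigoplus_{n\ge0}A_n$ over $\mathbb Z$ with an inner product $\langle\cdot,\cdot\rangle$ and a distinguished orthogonal $\mathbb Z$-basis, finite in each degree, such that multiplication $m:A\otimes A\to A$ and comultiplication $\Delta:A\to A\otimes A$ are adjoint and take elements with non-negative coefficients in the basis to elements with non-negative coefficients. Connected means that the unit and the counit restricted to $A_0$ give an isomorphism of $A_0$ with $\mathbb Z$. For $x\in A$ define $m_x,\Delta_x:A\to A$ by $m_x=m\circ i_x$, $\Delta_x=j_x\circ\Delta$, where $i_x(y)=x\otimes y$ and $j_x(y\otimes z)=\langle x,y\rangle z$. *)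

theory Defs
  imports
    "HOL-Library.Poly_Mapping"
    "HOL-Computational_Algebra.Group_Closure"
    "HOL-Algebra.Subrings"
begin

section \<open>Abelian groups as modules over the integers\<close>

text \<open>At most one of the two sums is nonempty.\<close>

definition zscale :: "int \<Rightarrow> 'a::ab_group_add \<Rightarrow> 'a" where
  "zscale n x = (\<Sum>i<nat n. x) - (\<Sum>i<nat (- n). x)"

lemma zscale_zero_left [simp]: "zscale 0 x = 0"
  by (simp add: zscale_def)

lemma zscale_one [simp]: "zscale 1 x = x"
  by (simp add: zscale_def)

lemma zscale_succ: "zscale (n + 1) x = zscale n x + x"
proof (cases "n \<ge> 0")
  case True
  then have "nat (n + 1) = Suc (nat n)" "nat (- n) = 0" "nat (- (n + 1)) = 0" by auto
  then show ?thesis by (simp add: zscale_def)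
next
  case False
  then have "nat (- n) = Suc (nat (- (n + 1)))" "nat (n + 1) = 0" "nat n = 0" by auto
  then show ?thesis by (simp add: zscale_def)
qed

lemma zscale_pred: "zscale (n - 1) x = zscale n x - x"
  using zscale_succ[of "n - 1" x] by (simp add: algebra_simps)

lemma zscale_add_left: "zscale (m + n) x = zscale m x + zscale n x"
proof (induction n rule: int_induct[where k = 0])
  case (step1 i)
  then show ?case using zscale_succ[of "m + i" x] by (simp add: zscale_succ add.assoc)
next
  case (step2 i)
  then show ?case using zscale_pred[of "m + i" x] by (simp add: zscale_pred add_diff_eq)
qed simp

lemma zscale_add_right: "zscale n (x + y) = zscale n x + zscale n y"
  by (induction n rule: int_induct[where k = 0])
    (simp_all add: zscale_succ zscale_pred algebra_simps)

lemma zscale_diff_left: "zscale (m - n) x = zscale m x - zscale n x"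
  using zscale_add_left[of "m - n" n x] by (simp add: algebra_simps)

lemma zscale_zscale: "zscale m (zscale n x) = zscale (m * n) x"
  by (induction m rule: int_induct[where k = 0])
    (simp_all add: zscale_succ zscale_pred zscale_add_left zscale_diff_left
      distrib_right left_diff_distrib)

lemma module_zscale: "Modules.module (zscale :: int \<Rightarrow> 'a::ab_group_add \<Rightarrow> 'a)"
  by unfold_locales (simp_all add: zscale_add_left zscale_add_right zscale_zscale)

lemma additive_zscale: assumes "additive f" shows "f (zscale n x) = zscale n (f x)"
proof -
  interpret additive f by fact
  show ?thesis
    by (induction n rule: int_induct[where k = 0])
      (simp_all add: zscale_succ zscale_pred zero add diff)
qed

lemma zscale_int [simp]: "zscale n (x::int) = n * x"
  by (induction n rule: int_induct[where k = 0])
    (simp_all add: zscale_succ zscale_pred algebra_simps)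

lemma zscale_eq_of_int_mult: "zscale n (x::'a::ring_1) = of_int n * x"
  by (induction n rule: int_induct[where k = 0])
    (simp_all add: zscale_succ zscale_pred algebra_simps)

definition biadditive :: "('a::ab_group_add \<Rightarrow> 'b::ab_group_add \<Rightarrow> 'c::ab_group_add) \<Rightarrow> bool" where
  "biadditive f \<longleftrightarrow> (\<forall>y. additive (\<lambda>x. f x y)) \<and> (\<forall>x. additive (f x))"

lemma biadditiveI:
  assumes "\<And>x x' y. f (x + x') y = f x y + f x' y" "\<And>x y y'. f x (y + y') = f x y + f x y'"
  shows "biadditive f"
  using assms by (simp add: biadditive_def additive_def)

lemma biadditive_add:
  assumes "biadditive f"
  shows "f (x + x') y = f x y + f x' y" "f x (y + y') = f x y + f x y'"
  using assms by (simp_all add: biadditive_def additive_def)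

definition is_Z_basis :: "'a::ab_group_add set \<Rightarrow> bool" where
  "is_Z_basis B \<longleftrightarrow> \<not> Modules.module.dependent zscale B \<and> Modules.module.span zscale B = UNIV"

definition nonneg_combinations :: "'a::ab_group_add set \<Rightarrow> 'a set" where
  "nonneg_combinations B =
     {\<Sum>b\<in>T. zscale (c b) b | T c. finite T \<and> T \<subseteq> B \<and> (\<forall>b\<in>T. 0 \<le> c b)}"

section \<open>Tensor products over the integers\<close>

definition tensor_relations :: "('a::ab_group_add \<times> 'b::ab_group_add \<Rightarrow>\<^sub>0 int) set" where
  "tensor_relations = group_closure
    ({frag_of (x + x', y) - frag_of (x, y)
        - frag_of (x', y) | x x' y. True} \<union>
     {frag_of (x, y + y') - frag_of (x, y)
        - frag_of (x, y') | x y y'. True})"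

definition tensor_eq ::
  "('a::ab_group_add \<times> 'b::ab_group_add \<Rightarrow>\<^sub>0 int) \<Rightarrow> ('a \<times> 'b \<Rightarrow>\<^sub>0 int) \<Rightarrow> bool" where
  "tensor_eq u v \<longleftrightarrow> u - v \<in> tensor_relations"

lemma tensor_relations_add:
  "u \<in> tensor_relations \<Longrightarrow> v \<in> tensor_relations \<Longrightarrow> u + v \<in> tensor_relations"
  and tensor_relations_diff:
  "u \<in> tensor_relations \<Longrightarrow> v \<in> tensor_relations \<Longrightarrow> u - v \<in> tensor_relations"
  and tensor_relations_minus: "u \<in> tensor_relations \<Longrightarrow> - u \<in> tensor_relations"
  and tensor_relations_zero: "0 \<in> tensor_relations"
  unfolding tensor_relations_def
  by (auto intro: group_closure_add group_closure.diff)

lemma tensor_eq_trans: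
  assumes "tensor_eq u v" "tensor_eq v w"
  shows "tensor_eq u w"
proof -
  from assms have "(u - v) + (v - w) \<in> tensor_relations"
    unfolding tensor_eq_def by (rule tensor_relations_add)
  then show ?thesis by (simp add: tensor_eq_def)
qed

lemma equivp_tensor_eq: "equivp tensor_eq"
proof (rule equivpI)
  show "reflp tensor_eq"
    by (simp add: reflp_def tensor_eq_def tensor_relations_zero)
  show "symp tensor_eq"
    unfolding symp_def tensor_eq_def using tensor_relations_minus by (metis minus_diff_eq)
  show "transp tensor_eq"
    by (rule transpI) (rule tensor_eq_trans)
qed

quotient_type (overloaded) ('a, 'b) tensor =
  "('a::ab_group_add \<times> 'b::ab_group_add) \<Rightarrow>\<^sub>0 int" / tensor_eq
  by (rule equivp_tensor_eq)

instantiation tensor :: (ab_group_add, ab_group_add) ab_group_add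
begin

lift_definition zero_tensor :: "('a, 'b) tensor" is 0 .

lift_definition plus_tensor :: "('a, 'b) tensor \<Rightarrow> ('a, 'b) tensor \<Rightarrow> ('a, 'b) tensor" is "(+)"
proof -
  fix u u' :: "'a \<times> 'b \<Rightarrow>\<^sub>0 int" and v v' :: "'a \<times> 'b \<Rightarrow>\<^sub>0 int"
  assume "tensor_eq u u'" "tensor_eq v v'"
  then have "(u - u') + (v - v') \<in> tensor_relations"
    unfolding tensor_eq_def by (rule tensor_relations_add)
  moreover have "(u - u') + (v - v') = (u + v) - (u' + v')" by simp
  ultimately show "tensor_eq (u + v) (u' + v')" by (simp only: tensor_eq_def)
qed

lift_definition minus_tensor :: "('a, 'b) tensor \<Rightarrow> ('a, 'b) tensor \<Rightarrow> ('a, 'b) tensor" is "(-)"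
proof -
  fix u u' :: "'a \<times> 'b \<Rightarrow>\<^sub>0 int" and v v' :: "'a \<times> 'b \<Rightarrow>\<^sub>0 int"
  assume "tensor_eq u u'" "tensor_eq v v'"
  then have "(u - u') - (v - v') \<in> tensor_relations"
    unfolding tensor_eq_def by (rule tensor_relations_diff)
  moreover have "(u - u') - (v - v') = (u - v) - (u' - v')" by simp
  ultimately show "tensor_eq (u - v) (u' - v')" by (simp only: tensor_eq_def)
qed

lift_definition uminus_tensor :: "('a, 'b) tensor \<Rightarrow> ('a, 'b) tensor" is uminus
proof -
  fix u u' :: "'a \<times> 'b \<Rightarrow>\<^sub>0 int"
  assume "tensor_eq u u'"
  then have "- (u - u') \<in> tensor_relations"
    unfolding tensor_eq_def by (rule tensor_relations_minus)
  moreover have "- (u - u') = - u - - u'" by simp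
  ultimately show "tensor_eq (- u) (- u')" by (simp only: tensor_eq_def)
qed

instance
proof
  fix a b c :: "('a, 'b) tensor"
  show "a + b + c = a + (b + c)"
    by transfer (simp add: tensor_eq_def tensor_relations_zero add.assoc)
  show "a + b = b + a"
    by transfer (simp add: tensor_eq_def tensor_relations_zero add.commute)
  show "0 + a = a"
    by transfer (simp add: tensor_eq_def tensor_relations_zero)
  show "- a + a = 0"
    by transfer (simp add: tensor_eq_def tensor_relations_zero)
  show "a - b = a + - b"
    by transfer (simp add: tensor_eq_def tensor_relations_zero)
qed

end

lift_definition tens :: "'a::ab_group_add \<Rightarrow> 'b::ab_group_add \<Rightarrow> ('a, 'b) tensor"
  is "\<lambda>x y. frag_of (x, y)" .

lemma biadditive_tens: "biadditive tens"
proof (rule biadditiveI)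
  fix x x' :: 'a and y :: 'b
  show "tens (x + x') y = tens x y + tens x' y"
    by transfer (unfold tensor_eq_def tensor_relations_def diff_diff_eq[symmetric],
      rule group_closure.base, blast)
next
  fix x :: 'a and y y' :: 'b
  show "tens x (y + y') = tens x y + tens x y'"
    by transfer (unfold tensor_eq_def tensor_relations_def diff_diff_eq[symmetric],
      rule group_closure.base, blast)
qed

definition free_extend :: "('p \<Rightarrow> 'c::ab_group_add) \<Rightarrow> ('p \<Rightarrow>\<^sub>0 int) \<Rightarrow> 'c" where
  "free_extend f u = (\<Sum>p\<in>Poly_Mapping.keys u. zscale (Poly_Mapping.lookup u p) (f p))"

lemma free_extend_superset:
  assumes "finite T" "Poly_Mapping.keys u \<subseteq> T"
  shows "free_extend f u = (\<Sum>p\<in>T. zscale (Poly_Mapping.lookup u p) (f p))"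
  unfolding free_extend_def
  by (rule sum.mono_neutral_left) (use assms in \<open>auto simp: in_keys_iff\<close>)

lemma free_extend_add: "free_extend f (u + v) = free_extend f u + free_extend f v"
proof -
  let ?T = "Poly_Mapping.keys u \<union> Poly_Mapping.keys v"
  have "Poly_Mapping.keys (u + v) \<subseteq> ?T" by (rule Poly_Mapping.keys_add)
  then show ?thesis
    by (subst (1 2 3) free_extend_superset[where T = ?T])
      (auto simp: lookup_add zscale_add_left sum.distrib)
qed

lemma additive_free_extend: "additive (free_extend f)"
  by (simp add: additive_def free_extend_add)

lemma free_extend_single [simp]: "free_extend f (Poly_Mapping.single p 1) = f p"
  by (simp add: free_extend_def)

text \<open>For biadditive \<open>f\<close> the value does not depend on the chosen representative, so that
  \<open>tensor_lift f\<close> is the unique additive map sending every \<open>tens x y\<close> to \<open>f x y\<close>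
  (see \<open>additive_tensor_lift\<close>, \<open>tensor_lift_tens\<close>, \<open>tensor_lift_unique\<close>).  It is only ever
  applied to biadditive functions.\<close>

definition tensor_lift ::
  "('a::ab_group_add \<Rightarrow> 'b::ab_group_add \<Rightarrow> 'c::ab_group_add) \<Rightarrow> ('a, 'b) tensor \<Rightarrow> 'c" where
  "tensor_lift f t = free_extend (\<lambda>(x, y). f x y) (rep_tensor t)"

lemma tensor_lift_add_fun:
  "tensor_lift (\<lambda>x y. f x y + g x y) t = tensor_lift f t + tensor_lift g t"
  by (simp add: tensor_lift_def free_extend_def zscale_add_right sum.distrib split_beta)

lemma free_extend_relations:
  assumes f: "biadditive f" and "u \<in> tensor_relations"
  shows "free_extend (\<lambda>(x, y). f x y) u = 0"
proof -
  interpret E: additive "free_extend (\<lambda>(x, y). f x y)" by (rule additive_free_extend)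
  from assms(2) show ?thesis
    unfolding tensor_relations_def
    by (induction rule: group_closure.induct) (auto simp: E.diff E.zero biadditive_add[OF f])
qed

lemma tensor_lift_abs:
  assumes "biadditive f"
  shows "tensor_lift f (abs_tensor u) = free_extend (\<lambda>(x, y). f x y) u"
proof -
  interpret E: additive "free_extend (\<lambda>(x, y). f x y)" by (rule additive_free_extend)
  have "tensor_eq (rep_tensor (abs_tensor u)) u"
    by (rule Quotient3_rep_abs[OF Quotient3_tensor])
      (simp add: tensor_eq_def tensor_relations_zero)
  then have "free_extend (\<lambda>(x, y). f x y) (rep_tensor (abs_tensor u) - u) = 0"
    by (intro free_extend_relations[OF assms]) (simp add: tensor_eq_def)
  then show ?thesis
    by (simp add: tensor_lift_def E.diff)
qed

lemma tensor_lift_tens [simp]: "biadditive f \<Longrightarrow> tensor_lift f (tens x y) = f x y"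
  by (simp add: tens.abs_eq tensor_lift_abs)

lemma additive_tensor_lift: assumes "biadditive f" shows "additive (tensor_lift f)"
proof
  fix t u :: "('a, 'b) tensor"
  obtain p q where "t = abs_tensor p" "u = abs_tensor q"
    by (metis Quotient3_abs_rep[OF Quotient3_tensor])
  then show "tensor_lift f (t + u) = tensor_lift f t + tensor_lift f u"
    by (simp add: plus_tensor.abs_eq tensor_lift_abs[OF assms] free_extend_add)
qed

lemma tensor_induct [case_names tens add minus]:
  assumes tens: "\<And>x y. P (tens x y)"
    and add: "\<And>t u. P t \<Longrightarrow> P u \<Longrightarrow> P (t + u)"
    and minus: "\<And>t. P t \<Longrightarrow> P (- t)"
  shows "P t"
proof -
  have zero: "P 0" using add[OF tens minus[OF tens], of 0 0 0 0] by simp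
  have scale: "P (zscale n (tens x y))" for n and x :: 'a and y :: 'b
  proof (induction n rule: int_induct[where k = 0])
    case base
    then show ?case by (simp add: zero)
  next
    case (step1 i)
    then show ?case by (simp add: zscale_succ add tens)
  next
    case (step2 i)
    then show ?case using add[OF step2(2) minus[OF tens]] by (simp add: zscale_pred)
  qed
  have single: "abs_tensor (Poly_Mapping.single (x, y) n) = zscale n (tens x y)"
    for n and x :: 'a and y :: 'b
  proof (induction n rule: int_induct[where k = 0])
    case base
    then show ?case by (simp add: zero_tensor.abs_eq)
  next
    case (step1 i)
    then show ?case
      by (simp add: zscale_succ tens.abs_eq plus_tensor.abs_eq[symmetric] single_add)
  next
    case (step2 i)
    then show ?case
      by (simp add: zscale_pred tens.abs_eq minus_tensor.abs_eq[symmetric] single_diff)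
  qed
  have "P (abs_tensor u)" for u :: "'a \<times> 'b \<Rightarrow>\<^sub>0 int"
  proof (induction u rule: Poly_Mapping.update_induct)
    case const
    then show ?case using zero by (simp add: zero_tensor.abs_eq)
  next
    case (update f a b)
    have "Poly_Mapping.update a b f = f + Poly_Mapping.single a b"
      using update(1) by (intro poly_mapping_eqI)
        (auto simp: lookup_update lookup_add lookup_single in_keys_iff when_def)
    then show ?case
      using update add scale single by (cases a) (simp add: plus_tensor.abs_eq[symmetric])
  qed
  then show ?thesis by (metis Quotient3_abs_rep[OF Quotient3_tensor])
qed

lemma tensor_additive_eqI:
  assumes "additive g" "additive h" "\<And>x y. g (tens x y) = h (tens x y)"
  shows "g t = h t"
proof -
  interpret g: additive g by fact
  interpret h: additive h by fact
  show ?thesis by (induction t rule: tensor_induct) (simp_all add: assms g.add h.add g.minus h.minus)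
qed

lemma tensor_lift_unique:
  assumes "biadditive f" "additive h" "\<And>x y. h (tens x y) = f x y"
  shows "h = tensor_lift f"
  by (rule ext, rule tensor_additive_eqI) (simp_all add: assms additive_tensor_lift)

definition tensor_map :: "('a::ab_group_add \<Rightarrow> 'c::ab_group_add) \<Rightarrow>
    ('b::ab_group_add \<Rightarrow> 'd::ab_group_add) \<Rightarrow> ('a, 'b) tensor \<Rightarrow> ('c, 'd) tensor" where
  "tensor_map f g = tensor_lift (\<lambda>x y. tens (f x) (g y))"

definition tensor_assoc :: "(('a::ab_group_add, 'b::ab_group_add) tensor, 'c::ab_group_add) tensor \<Rightarrow>
    ('a, ('b, 'c) tensor) tensor" where
  "tensor_assoc = tensor_lift (\<lambda>t z. tensor_lift (\<lambda>x y. tens x (tens y z)) t)"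

text \<open>The product on the tensor product of two rings is
  \<open>(x \<otimes> y) (x' \<otimes> y') = x x' \<otimes> y y'\<close>, without a sign.\<close>

instantiation tensor :: (ring, ring) times
begin
definition times_tensor :: "('a, 'b) tensor \<Rightarrow> ('a, 'b) tensor \<Rightarrow> ('a, 'b) tensor" where
  "t * u = tensor_lift (\<lambda>x y. tensor_lift (\<lambda>x' y'. tens (x * x') (y * y')) u) t"
instance ..
end

lemma times_tens:
  fixes x x' :: "'a::ring" and y y' :: "'b::ring"
  shows "tens x y * tens x' y' = tens (x * x') (y * y')"
proof -
  have b: "biadditive (\<lambda>x' y'. tens (x * x') (y * y'))" for x :: 'a and y :: 'b
    by (rule biadditiveI) (simp_all add: distrib_left biadditive_add[OF biadditive_tens])
  have "biadditive (\<lambda>x y. tens (x * x') (y * y'))"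
    by (rule biadditiveI) (simp_all add: distrib_right biadditive_add[OF biadditive_tens])
  then show ?thesis by (simp add: times_tensor_def b)
qed

instantiation tensor :: (ring_1, ring_1) one
begin
definition one_tensor :: "('a, 'b) tensor" where "1 = tens 1 1"
instance ..
end

section \<open>Graded Hopf algebras\<close>

definition tensor_mult :: "('a::ring, 'a) tensor \<Rightarrow> 'a" where
  "tensor_mult = tensor_lift (*)"

locale hopf_algebra =
  fixes \<Delta> :: "'a::ring_1 \<Rightarrow> ('a, 'a) tensor"
    and \<epsilon> :: "'a \<Rightarrow> int"
    and S :: "'a \<Rightarrow> 'a"
  assumes additive_comult: "additive \<Delta>"
    and additive_counit: "additive \<epsilon>"
    and additive_antipode: "additive S"
    and coassoc: "tensor_assoc (tensor_map \<Delta> id (\<Delta> x)) = tensor_map id \<Delta> (\<Delta> x)"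
    and counit_left: "tensor_lift (\<lambda>x y. zscale (\<epsilon> x) y) (\<Delta> x) = x"
    and counit_right: "tensor_lift (\<lambda>x y. zscale (\<epsilon> y) x) (\<Delta> x) = x"
    and comult_mult: "\<Delta> (x * y) = \<Delta> x * \<Delta> y"
    and comult_one: "\<Delta> 1 = 1"
    and counit_mult: "\<epsilon> (x * y) = \<epsilon> x * \<epsilon> y"
    and counit_one: "\<epsilon> 1 = 1"
    and antipode_left: "tensor_mult (tensor_map S id (\<Delta> x)) = of_int (\<epsilon> x)"
    and antipode_right: "tensor_mult (tensor_map id S (\<Delta> x)) = of_int (\<epsilon> x)"

definition is_grading :: "(nat \<Rightarrow> 'a::ab_group_add set) \<Rightarrow> bool" where
  "is_grading G \<longleftrightarrow>
     (\<forall>n. 0 \<in> G n \<and> (\<forall>x\<in>G n. \<forall>y\<in>G n. x - y \<in> G n)) \<and>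
     (\<forall>x. \<exists>!c. (\<forall>n. c n \<in> G n) \<and> finite {n. c n \<noteq> 0} \<and> x = (\<Sum>n | c n \<noteq> 0. c n))"

definition tensor_degree :: "(nat \<Rightarrow> 'a::ab_group_add set) \<Rightarrow> nat \<Rightarrow> ('a, 'a) tensor set" where
  "tensor_degree G n = group_closure {tens x y | x y. \<exists>i j. i + j = n \<and> x \<in> G i \<and> y \<in> G j}"

locale graded_hopf_algebra = hopf_algebra \<Delta> \<epsilon> S
  for \<Delta> :: "'a::ring_1 \<Rightarrow> ('a, 'a) tensor" and \<epsilon> S +
  fixes G :: "nat \<Rightarrow> 'a set"
  assumes grading: "is_grading G"
    and one_degree: "1 \<in> G 0"
    and mult_degree: "x \<in> G i \<Longrightarrow> y \<in> G j \<Longrightarrow> x * y \<in> G (i + j)"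
    and counit_degree: "x \<in> G n \<Longrightarrow> n > 0 \<Longrightarrow> \<epsilon> x = 0"
    and comult_degree: "x \<in> G n \<Longrightarrow> \<Delta> x \<in> tensor_degree G n"
    and antipode_degree: "x \<in> G n \<Longrightarrow> S x \<in> G n"

locale connected_graded_hopf_algebra = graded_hopf_algebra +
  assumes unit_iso: "bij_betw (of_int :: int \<Rightarrow> 'a::ring_1) UNIV (G 0)"
    and counit_iso: "bij_betw \<epsilon> (G 0) UNIV"

section \<open>PSH algebras\<close>

text \<open>The inner product induced on the tensor square:
  \<open>\<langle>x \<otimes> y, x' \<otimes> y'\<rangle> = \<langle>x, x'\<rangle> \<langle>y, y'\<rangle>\<close>.\<close>

definition tensor_inner :: "('a::ab_group_add \<Rightarrow> 'a \<Rightarrow> int) \<Rightarrow> ('a, 'a) tensor \<Rightarrow> ('a, 'a) tensor \<Rightarrow> int" where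
  "tensor_inner ip t u = tensor_lift (\<lambda>x y. tensor_lift (\<lambda>x' y'. ip x x' * ip y y') u) t"

definition tensor_basis :: "'a::ab_group_add set \<Rightarrow> ('a, 'a) tensor set" where
  "tensor_basis B = {tens b b' | b b'. b \<in> B \<and> b' \<in> B}"

text \<open>The basis is only required to be orthogonal, not orthonormal.  A homogeneous basis is what
  makes finiteness in each degree meaningful.\<close>

locale psh_algebra = connected_graded_hopf_algebra \<Delta> \<epsilon> S G
  for \<Delta> :: "'a::ring_1 \<Rightarrow> ('a, 'a) tensor" and \<epsilon> S G +
  fixes ip :: "'a \<Rightarrow> 'a \<Rightarrow> int"
    and \<Omega> :: "'a set"
  assumes inner_biadditive: "biadditive ip"
    and inner_commute: "ip x y = ip y x"
    and inner_pos: "x \<noteq> 0 \<Longrightarrow> ip x x > 0"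
    and basis: "is_Z_basis \<Omega>"
    and basis_orthogonal: "b \<in> \<Omega> \<Longrightarrow> b' \<in> \<Omega> \<Longrightarrow> b \<noteq> b' \<Longrightarrow> ip b b' = 0"
    and basis_homogeneous: "\<Omega> \<subseteq> (\<Union>n. G n)"
    and basis_finite: "finite (\<Omega> \<inter> G n)"
    and self_adjoint: "ip (tensor_mult t) x = tensor_inner ip t (\<Delta> x)"
    and mult_positive:
      "t \<in> nonneg_combinations (tensor_basis \<Omega>) \<Longrightarrow> tensor_mult t \<in> nonneg_combinations \<Omega>"
    and comult_positive:
      "x \<in> nonneg_combinations \<Omega> \<Longrightarrow> \<Delta> x \<in> nonneg_combinations (tensor_basis \<Omega>)"

section \<open>The map to the endomorphism ring\<close>

definition End_Z :: "('a::ab_group_add \<Rightarrow> 'a) ring" where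
  "End_Z = \<lparr>carrier = {f. additive f}, mult = (\<circ>), one = id,
            zero = (\<lambda>_. 0), add = (\<lambda>f g x. f x + g x)\<rparr>"

lemma ring_End_Z: "ring (End_Z :: ('a::ab_group_add \<Rightarrow> 'a) ring)"
proof (rule ringI)
  show "abelian_group (End_Z :: ('a \<Rightarrow> 'a) ring)"
  proof (rule abelian_groupI)
    fix f :: "'a \<Rightarrow> 'a" assume "f \<in> carrier End_Z"
    then interpret additive f by (simp add: End_Z_def)
    have "additive (\<lambda>x. - f x)" by unfold_locales (simp add: add)
    then show "\<exists>g\<in>carrier End_Z. g \<oplus>\<^bsub>End_Z\<^esub> f = \<zero>\<^bsub>End_Z\<^esub>"
      by (intro bexI[where x = "\<lambda>x. - f x"]) (simp_all add: End_Z_def)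
  qed (auto simp: End_Z_def additive_def algebra_simps)
  show "monoid (End_Z :: ('a \<Rightarrow> 'a) ring)"
    by (rule monoidI) (auto simp: End_Z_def additive_def fun_eq_iff)
qed (auto simp: End_Z_def additive_def fun_eq_iff)

definition mult_op :: "'a::ring \<Rightarrow> 'a \<Rightarrow> 'a" where
  "mult_op x = tensor_mult \<circ> (\<lambda>y. tens x y)"

definition comult_op ::
  "('a::ab_group_add \<Rightarrow> ('a, 'a) tensor) \<Rightarrow> ('a \<Rightarrow> 'a \<Rightarrow> int) \<Rightarrow> 'a \<Rightarrow> 'a \<Rightarrow> 'a" where
  "comult_op \<Delta> ip x = tensor_lift (\<lambda>y z. zscale (ip x y) z) \<circ> \<Delta>"

text \<open>Since addition in \<open>End_Z\<close> is pointwise, the additive map with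
  \<open>x \<otimes> y \<mapsto> m\<^sub>x \<Delta>\<^sub>y\<close> can be obtained by lifting pointwise.\<close>

definition psh_map ::
  "('a::ring \<Rightarrow> ('a, 'a) tensor) \<Rightarrow> ('a \<Rightarrow> 'a \<Rightarrow> int) \<Rightarrow> ('a, 'a) tensor \<Rightarrow> 'a \<Rightarrow> 'a" where
  "psh_map \<Delta> ip t = (\<lambda>z. tensor_lift (\<lambda>x y. (mult_op x \<circ> comult_op \<Delta> ip y) z) t)"

lemma mult_op_eq [simp]: "mult_op x y = x * y"
  by (simp add: mult_op_def tensor_mult_def biadditiveI algebra_simps)

lemma additive_comult_op:
  assumes "additive \<Delta>" "biadditive ip"
  shows "additive (comult_op \<Delta> ip x)"
proof -
  interpret D: additive \<Delta> by fact
  have "biadditive (\<lambda>y z. zscale (ip x y) z)"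
    by (rule biadditiveI) (simp_all add: biadditive_add[OF assms(2)] zscale_add_left zscale_add_right)
  then interpret j: additive "tensor_lift (\<lambda>y z. zscale (ip x y) z)"
    by (rule additive_tensor_lift)
  show ?thesis by unfold_locales (simp add: comult_op_def D.add j.add)
qed

lemma comult_op_add_left:
  assumes "biadditive ip"
  shows "comult_op \<Delta> ip (x + x') z = comult_op \<Delta> ip x z + comult_op \<Delta> ip x' z"
  by (simp add: comult_op_def biadditive_add[OF assms] zscale_add_left tensor_lift_add_fun)

lemma
  assumes "additive \<Delta>" "biadditive ip"
  shows additive_psh_map: "psh_map \<Delta> ip (t + u) = psh_map \<Delta> ip t \<oplus>\<^bsub>End_Z\<^esub> psh_map \<Delta> ip u"
    and psh_map_tens: "psh_map \<Delta> ip (tens x y) = mult_op x \<circ> comult_op \<Delta> ip y"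
    and psh_map_in_End_Z: "psh_map \<Delta> ip t \<in> carrier End_Z"
proof -
  have b: "biadditive (\<lambda>x y. (mult_op x \<circ> comult_op \<Delta> ip y) z)" for z
    by (rule biadditiveI) (simp_all add: comult_op_add_left[OF assms(2)] algebra_simps)
  interpret L: additive "tensor_lift (\<lambda>x y. (mult_op x \<circ> comult_op \<Delta> ip y) z)" for z
    by (rule additive_tensor_lift[OF b])
  show add: "psh_map \<Delta> ip (t + u) = psh_map \<Delta> ip t \<oplus>\<^bsub>End_Z\<^esub> psh_map \<Delta> ip u" for t u
    by (simp only: psh_map_def L.add End_Z_def ring.simps)
  show tens: "psh_map \<Delta> ip (tens x y) = mult_op x \<circ> comult_op \<Delta> ip y" for x y
    by (simp only: psh_map_def tensor_lift_tens[OF b])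
  have minus: "psh_map \<Delta> ip (- t) = (\<lambda>z. - psh_map \<Delta> ip t z)" for t
    by (simp only: psh_map_def L.minus)
  interpret C: additive "comult_op \<Delta> ip y" for y by (rule additive_comult_op[OF assms])
  show "psh_map \<Delta> ip t \<in> carrier End_Z"
    by (induction t rule: tensor_induct)
      (auto simp: tens add minus End_Z_def additive_def C.add algebra_simps)
qed

end

theory Submission
  imports Defs
begin

text \<open>Self-adjointness says that \<open>\<Delta>\<^sub>y\<close> is the adjoint of \<open>m\<^sub>y\<close>. As the inner product is
  non-degenerate, this gives \<open>\<Delta>\<^sub>1 = id\<close> and \<open>\<Delta>\<^sub>x \<Delta>\<^sub>y = \<Delta>\<^bsub>y x\<^esub>\<close>. Multiplicativity of the
  comultiplication then gives \<open>\<Delta>\<^sub>y (x z) = \<Sum> \<Delta>\<^sub>a x \<cdot> \<Delta>\<^sub>b z\<close> for \<open>\<Delta> y = \<Sum> a \<otimes> b\<close>, so that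
  \<open>\<Delta>\<^sub>y m\<^sub>x\<close> lies in the image of \<open>\<phi>\<close> and the image is closed under composition.

  For injectivity, write \<open>t = \<Sum> f b \<otimes> b\<close> over finitely many basis elements \<open>b\<close>. By connectedness
  \<open>\<Delta>\<^sub>b z = \<langle>b, z\<rangle> 1\<close> whenever \<open>deg b \<ge> deg z\<close>. If \<open>\<phi> t = 0\<close> and \<open>f c = 0\<close> for all \<open>c\<close> of degree
  below \<open>deg b\<close>, then evaluating \<open>\<phi> t\<close> at \<open>b\<close> leaves \<open>\<langle>b, b\<rangle> f b = 0\<close>, so \<open>f b = 0\<close>.\<close>

section \<open>Additive maps and expansions in a basis\<close>

lemma biadditive_compose_additive:
  assumes "biadditive f" "additive h"
  shows "biadditive (\<lambda>x y. h (f x y))"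
  using assms by (simp add: biadditive_def additive_def)

lemma additive_tensor_lift_commute:
  assumes "additive h" "biadditive f"
  shows "h (tensor_lift f t) = tensor_lift (\<lambda>x y. h (f x y)) t"
proof (rule tensor_additive_eqI[where g = "\<lambda>t. h (tensor_lift f t)"])
  show "additive (\<lambda>t. h (tensor_lift f t))"
    using additive_tensor_lift[OF assms(2)] assms(1) by (simp add: additive_def)
qed (simp_all add: assms additive_tensor_lift biadditive_compose_additive)

lemma additive_sum_eq:
  assumes "additive f"
  shows "f (\<Sum>i\<in>I. g i) = (\<Sum>i\<in>I. f (g i))"
proof -
  interpret additive f by fact
  show ?thesis by (rule sum)
qed

lemma is_Z_basis_exE:
  assumes "is_Z_basis B"
  obtains T c where "finite T" "T \<subseteq> B" "x = (\<Sum>b\<in>T. zscale (c b) b)"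
proof -
  interpret Z: Modules.module "zscale :: int \<Rightarrow> 'a \<Rightarrow> 'a" by (rule module_zscale)
  have "x \<in> Z.span B" using assms by (simp add: is_Z_basis_def)
  then show ?thesis using that unfolding Z.span_explicit by blast
qed

lemma is_Z_basis_nonzero:
  assumes "is_Z_basis B" "b \<in> B"
  shows "b \<noteq> 0"
proof -
  interpret Z: Modules.module "zscale :: int \<Rightarrow> 'a \<Rightarrow> 'a" by (rule module_zscale)
  show ?thesis using assms Z.dependent_zero by (auto simp: is_Z_basis_def)
qed

text \<open>Expand the right factor of each pure tensor in the basis and move the integer
  coefficients into the left factor. For a sum of two tensors, both expansions are extended by zero
  to the union of their supports.\<close>

lemma tensor_basis_expansion:
  fixes t :: "('a::ab_group_add, 'b::ab_group_add) tensor"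
  assumes "is_Z_basis B"
  shows "\<exists>T f. finite T \<and> T \<subseteq> B \<and> t = (\<Sum>b\<in>T. tens (f b) b)"
proof (induction t rule: tensor_induct)
  case (tens x y)
  obtain T c where T: "finite T" "T \<subseteq> B" "y = (\<Sum>b\<in>T. zscale (c b) b)"
    by (rule is_Z_basis_exE[OF assms])
  have l: "additive (\<lambda>x. tens x b)" and r: "additive (tens x)" for x :: 'a and b :: 'b
    using biadditive_tens by (auto simp: biadditive_def)
  have "tens x y = (\<Sum>b\<in>T. tens (zscale (c b) x) b)"
    unfolding T(3) additive_sum_eq[OF r]
    by (rule sum.cong) (simp_all add: additive_zscale[OF l] additive_zscale[OF r])
  with T(1,2) show ?case
    by (intro exI[where x = T] exI[where x = "\<lambda>b. zscale (c b) x"]) simp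
next
  case (add t u)
  obtain T f where T: "finite T" "T \<subseteq> B" "t = (\<Sum>b\<in>T. tens (f b) b)"
    using add.IH(1) by (elim exE conjE) (rule that)
  obtain U g where U: "finite U" "U \<subseteq> B" "u = (\<Sum>b\<in>U. tens (g b) b)"
    using add.IH(2) by (elim exE conjE) (rule that)
  interpret l: additive "\<lambda>x. tens x b" for b :: 'b
    using biadditive_tens by (auto simp: biadditive_def)
  define f' where "f' b = (if b \<in> T then f b else 0)" for b
  define g' where "g' b = (if b \<in> U then g b else 0)" for b
  have "t = (\<Sum>b\<in>T \<union> U. tens (f' b) b)"
    unfolding T(3) by (rule sum.mono_neutral_cong_left) (auto simp: T(1) U(1) f'_def l.zero)
  moreover have "u = (\<Sum>b\<in>T \<union> U. tens (g' b) b)"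
    unfolding U(3) by (rule sum.mono_neutral_cong_left) (auto simp: T(1) U(1) g'_def l.zero)
  ultimately have "t + u = (\<Sum>b\<in>T \<union> U. tens (f' b + g' b) b)"
    by (simp add: sum.distrib l.add)
  with T U show ?case by (intro exI[where x = "T \<union> U"] exI[where x = "\<lambda>b. f' b + g' b"]) auto
next
  case (minus t)
  obtain T f where *: "finite T" "T \<subseteq> B" "t = (\<Sum>b\<in>T. tens (f b) b)"
    using minus.IH by (elim exE conjE) (rule that)
  interpret l: additive "\<lambda>x. tens x b" for b :: 'b
    using biadditive_tens by (auto simp: biadditive_def)
  have "- t = (\<Sum>b\<in>T. tens (- f b) b)" by (simp add: *(3) l.minus sum_negf)
  with *(1,2) show ?case
    by (intro exI[where x = T] exI[where x = "\<lambda>b. - f b"]) simp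
qed

section \<open>Homogeneous components\<close>

lemma is_grading_sum_closed:
  assumes "is_grading G" "finite I" "\<And>i. i \<in> I \<Longrightarrow> f i \<in> G n"
  shows "(\<Sum>i\<in>I. f i) \<in> G n"
proof -
  have diff: "x - y \<in> G n" if "x \<in> G n" "y \<in> G n" for x y
    using assms(1) that by (auto simp: is_grading_def)
  have z: "0 \<in> G n" using assms(1) by (auto simp: is_grading_def)
  have add: "x + y \<in> G n" if "x \<in> G n" "y \<in> G n" for x y
    using diff[OF that(1) diff[OF z that(2)]] by simp
  from assms(2,3) show ?thesis by (induction I rule: finite_induct) (auto intro: z add)
qed

lemma is_grading_zscale_closed:
  assumes "is_grading G" "x \<in> G n"
  shows "zscale k x \<in> G n"
proof -
  have "(\<Sum>i<m. x) \<in> G n" for m :: nat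
    by (rule is_grading_sum_closed[OF assms(1)]) (simp_all add: assms(2))
  with assms(1) show ?thesis unfolding zscale_def is_grading_def by blast
qed

text \<open>Collecting the summands by degree gives one homogeneous decomposition
  (\<open>p\<close>); the family concentrated in degree \<open>n\<close> with value \<open>x\<close>
  gives another (\<open>q\<close>). Uniqueness identifies them, and degree \<open>n\<close> is read
  off.\<close>

lemma is_grading_component:
  assumes G: "is_grading G" and x: "x \<in> G n"
    and T: "finite T" "x = (\<Sum>b\<in>T. f b)" "\<And>b. b \<in> T \<Longrightarrow> f b \<in> G (d b)"
  shows "x = (\<Sum>b | b \<in> T \<and> d b = n. f b)"
proof -
  define p where "p m = (\<Sum>b | b \<in> T \<and> d b = m. f b)" for m
  define q where "q m = (if m = n then x else 0)" for m
  have z: "0 \<in> G m" for m using G by (auto simp: is_grading_def)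
  have p_G: "p m \<in> G m" for m
    unfolding p_def by (rule is_grading_sum_closed[OF G]) (use T in auto)
  have sub: "{m. p m \<noteq> 0} \<subseteq> d ` T"
  proof
    fix m assume "m \<in> {m. p m \<noteq> 0}"
    then have "{b \<in> T. d b = m} \<noteq> {}" by (metis (mono_tags) p_def mem_Collect_eq sum.empty)
    then show "m \<in> d ` T" by auto
  qed
  then have fin: "finite {m. p m \<noteq> 0}" using T(1) by (meson finite_imageI finite_subset)
  have "x = (\<Sum>m\<in>d ` T. p m)"
    unfolding T(2) p_def using sum.image_gen[OF T(1), of f d] by simp
  also have "\<dots> = (\<Sum>m | p m \<noteq> 0. p m)"
    by (rule sum.mono_neutral_right) (use T(1) sub in auto)
  finally have p: "x = (\<Sum>m | p m \<noteq> 0. p m)" .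
  have "(\<Sum>m | q m \<noteq> 0. q m) = (\<Sum>m\<in>{n}. q m)"
    by (rule sum.mono_neutral_left) (auto simp: q_def)
  then have q: "x = (\<Sum>m | q m \<noteq> 0. q m)" by (simp add: q_def)
  have "finite {m. q m \<noteq> 0}" by (rule finite_subset[of _ "{n}"]) (auto simp: q_def)
  moreover have "q m \<in> G m" for m using x z by (simp add: q_def)
  ultimately have "p = q" using G p_G fin p q unfolding is_grading_def by metis
  then have "p n = q n" by simp
  then show ?thesis by (simp add: p_def q_def)
qed

lemma zscale_mult_mult: "zscale (m * n) (x * y :: 'a::ring_1) = zscale m x * zscale n y"
proof -
  have "of_int n * (x * y) = x * (of_int n * y)"
    by (simp only: mult.assoc[symmetric] mult_of_int_commute[of n x])
  then show ?thesis by (simp add: zscale_eq_of_int_mult mult.assoc)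
qed

section \<open>Contractions and their adjointness to multiplication\<close>

context psh_algebra
begin

abbreviation skew :: "'a \<Rightarrow> 'a \<Rightarrow> 'a" where
  "skew \<equiv> comult_op \<Delta> ip"

text \<open>This is the map j_b, kept apart from \<Delta> so that its properties can be proved by
  induction over arbitrary tensors.\<close>

abbreviation contract :: "'a \<Rightarrow> ('a, 'a) tensor \<Rightarrow> 'a" where
  "contract b \<equiv> tensor_lift (\<lambda>y z. zscale (ip b y) z)"

lemma skew_eq: "skew b z = contract b (\<Delta> z)"
  by (simp add: comult_op_def)

lemmas ip_add = biadditive_add[OF inner_biadditive]

lemma ip_additive: "additive (ip x)" "additive (\<lambda>x. ip x y)"
  using inner_biadditive by (auto simp: biadditive_def)

lemma ip_zscale: "ip x (zscale k y) = k * ip x y" "ip (zscale k x) y = k * ip x y"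
  using additive_zscale[OF ip_additive(1)] additive_zscale[OF ip_additive(2)] by simp_all

lemma ip_zero [simp]: "ip x 0 = 0"
  using ip_zscale(1)[of x 0 0] by simp

lemma ip_nondegenerate:
  assumes "\<And>w. ip w x = ip w y"
  shows "x = y"
proof -
  interpret additive "ip (x - y)" by (rule ip_additive)
  have "ip (x - y) (x - y) = 0" using assms[of "x - y"] by (simp add: diff)
  then show ?thesis using inner_pos[of "x - y"] by auto
qed

text \<open>Positive definiteness rules out torsion: pairing \<open>zscale k x\<close> with
  \<open>x\<close> gives \<open>k * ip x x\<close>.\<close>

lemma zscale_eq_0_iff: "zscale k (x::'a) = 0 \<longleftrightarrow> k = 0 \<or> x = 0"
proof
  assume "zscale k x = 0"
  then have "k * ip x x = 0" using ip_zscale(1)[of x k x] by simp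
  then show "k = 0 \<or> x = 0" using inner_pos[of x] by auto
next
  assume "k = 0 \<or> x = 0"
  then show "zscale k x = 0" by (auto simp: zscale_eq_of_int_mult)
qed

lemma biadditive_contract: "biadditive (\<lambda>y z. zscale (ip b y) z)"
  by (rule biadditiveI) (simp_all add: ip_add zscale_add_left zscale_add_right)

lemma additive_contract: "additive (contract b)"
  by (rule additive_tensor_lift[OF biadditive_contract])

lemma contract_tens [simp]: "contract b (tens x y) = zscale (ip b x) y"
  by (rule tensor_lift_tens[OF biadditive_contract])

lemma skew_add_left: "skew (b + b') z = skew b z + skew b' z"
  by (rule comult_op_add_left[OF inner_biadditive])

lemma biadditive_ip_ip: "biadditive (\<lambda>a b. ip x a * ip y b)"
  by (rule biadditiveI) (simp_all add: ip_add algebra_simps)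

text \<open>Self-adjointness on a pure tensor, with \<open>tensor_inner\<close> evaluated. Both the
  adjointness of \<open>skew\<close> and the product rule for contractions rest on this
  form.\<close>

lemma ip_mult: "ip (x * y) z = tensor_lift (\<lambda>a b. ip x a * ip y b) (\<Delta> z)"
proof -
  have "biadditive (\<lambda>x y. tensor_lift (\<lambda>a b. ip x a * ip y b) u)" for u
    by (rule biadditiveI) (simp_all add: ip_add distrib_left distrib_right tensor_lift_add_fun)
  then have "tensor_inner ip (tens x y) u = tensor_lift (\<lambda>a b. ip x a * ip y b) u" for u
    by (simp add: tensor_inner_def)
  moreover have "tensor_mult (tens x y) = x * y"
    using mult_op_eq[of x y] by (simp add: mult_op_def)
  ultimately show ?thesis using self_adjoint[of "tens x y" z] by simp
qed

text \<open>Contracting the first factor of \<open>\<Delta> z\<close> with \<open>y\<close> and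
  pairing the second with \<open>w\<close> amounts to pairing \<open>\<Delta> z\<close> with
  \<open>tens y w\<close>.\<close>

lemma skew_adjoint: "ip w (skew y z) = ip (y * w) z"
  unfolding ip_mult skew_eq
  by (simp add: additive_tensor_lift_commute[OF ip_additive(1) biadditive_contract] ip_zscale)

lemma skew_1: "skew 1 z = z"
  by (rule ip_nondegenerate) (simp add: skew_adjoint)

text \<open>Passing to adjoints reverses the order of composition, hence
  \<open>y * x\<close>.\<close>

lemma skew_skew: "skew x (skew y z) = skew (y * x) z"
  by (rule ip_nondegenerate) (simp add: skew_adjoint mult.assoc)

section \<open>The product rule for contractions\<close>

lemma biadditive_times_tens: "biadditive (\<lambda>x y. tens (a * x) (b * y) :: ('a, 'a) tensor)"
  by (rule biadditiveI) (simp_all add: distrib_left biadditive_add[OF biadditive_tens])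

lemma biadditive_times_tensor:
  "biadditive (\<lambda>a b. tensor_lift (\<lambda>x y. tens (a * x) (b * y) :: ('a, 'a) tensor) u)"
  by (rule biadditiveI)
    (simp_all add: distrib_right biadditive_add[OF biadditive_tens] tensor_lift_add_fun)

text \<open>In the first argument this is additivity of the outer lift. In the second, the inner
  lift is additive once the first argument is pure, hence the induction.\<close>

lemma biadditive_tensor_times: "biadditive ((*) :: ('a, 'a) tensor \<Rightarrow> _)"
proof -
  have l: "additive (\<lambda>t. t * u)" for u :: "('a, 'a) tensor"
    unfolding times_tensor_def by (rule additive_tensor_lift[OF biadditive_times_tensor])
  interpret l: additive "\<lambda>t. t * u" for u :: "('a, 'a) tensor" by (rule l)
  have "t * (u + v) = t * u + t * v" for t u v :: "('a, 'a) tensor"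
  proof (induction t rule: tensor_induct)
    case (tens x y)
    interpret additive "tensor_lift (\<lambda>x' y'. tens (x * x') (y * y'))"
      by (rule additive_tensor_lift[OF biadditive_times_tens])
    show ?case
      unfolding times_tensor_def tensor_lift_tens[OF biadditive_times_tensor] by (rule add)
  next
    case (add t t')
    then show ?case by (simp add: l.add)
  next
    case (minus t)
    then show ?case by (simp add: l.minus)
  qed
  then show ?thesis using l by (simp add: biadditive_def additive_def)
qed

text \<open>For pure \<open>tens p q\<close> and \<open>tens r s\<close> the left side is
  \<open>ip (p * r) y\<close> times \<open>q * s\<close>, and \<open>ip_mult\<close> splits this
  pairing along \<open>\<Delta> y\<close>. Additivity in \<open>t\<close> and in \<open>u\<close>
  does the rest.\<close>

lemma contract_times:
  "contract y (t * u) = tensor_lift (\<lambda>a b. contract a t * contract b u) (\<Delta> y)"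
proof -
  interpret c: additive "contract a" for a by (rule additive_contract)
  interpret l: additive "\<lambda>v. v * w" for w :: "('a, 'a) tensor"
    using biadditive_tensor_times by (auto simp: biadditive_def)
  interpret r: additive "(*) v" for v :: "('a, 'a) tensor"
    using biadditive_tensor_times by (auto simp: biadditive_def)
  \<comment> \<open>The two lifts add up to the lift of the zero function; this serves the negation
    cases of both inductions.\<close>
  have neg: "tensor_lift (\<lambda>a b. - f a b) v = - tensor_lift f v"
    for f :: "'a \<Rightarrow> 'a \<Rightarrow> 'a" and v
    using tensor_lift_add_fun[of f "\<lambda>a b. - f a b" v]
    by (simp add: eq_neg_iff_add_eq_0 add.commute)
      (simp add: tensor_lift_def free_extend_def split_beta zscale_eq_of_int_mult)
  have tens: "contract y (tens p q * u) =
      tensor_lift (\<lambda>a b. contract a (tens p q) * contract b u) (\<Delta> y)" for p q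
  proof (induction u rule: tensor_induct)
    case (tens r s)
    have h: "additive (\<lambda>k. zscale k (q * s))" by (simp add: additive_def zscale_add_left)
    have "contract y (tens p q * tens r s) = zscale (ip (p * r) y) (q * s)"
      unfolding times_tens contract_tens by (subst inner_commute) (rule refl)
    also have "\<dots> = tensor_lift (\<lambda>a b. zscale (ip p a * ip r b) (q * s)) (\<Delta> y)"
      unfolding ip_mult by (rule additive_tensor_lift_commute[OF h biadditive_ip_ip])
    also have "(\<lambda>a b. zscale (ip p a * ip r b) (q * s)) =
        (\<lambda>a b. contract a (tens p q) * contract b (tens r s))"
      unfolding contract_tens zscale_mult_mult inner_commute[of p] inner_commute[of r] ..
    finally show ?case .
  next
    case (add t u)
    then show ?case by (simp add: r.add c.add distrib_left tensor_lift_add_fun)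
  next
    case (minus t)
    then show ?case by (simp add: r.minus c.minus neg)
  qed
  show ?thesis
  proof (induction t rule: tensor_induct)
    case (add t u)
    then show ?case by (simp add: l.add c.add distrib_right tensor_lift_add_fun)
  next
    case (minus t)
    then show ?case by (simp add: l.minus c.minus neg)
  qed (rule tens)
qed

lemma skew_mult: "skew y (x * z) = tensor_lift (\<lambda>a b. skew a x * skew b z) (\<Delta> y)"
  unfolding skew_eq comult_mult by (rule contract_times)

section \<open>Closure of the image under the ring operations\<close>

abbreviation phi :: "('a, 'a) tensor \<Rightarrow> 'a \<Rightarrow> 'a" where
  "phi \<equiv> psh_map \<Delta> ip"

lemma phi_add: "phi (t + u) z = phi t z + phi u z"
  using additive_psh_map[OF additive_comult inner_biadditive] by (simp add: End_Z_def)

lemma additive_phi: "additive (\<lambda>t. phi t z)"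
  by (simp add: additive_def phi_add)

lemma phi_tens: "phi (tens x y) z = x * skew y z"
  by (simp add: psh_map_tens[OF additive_comult inner_biadditive])

lemma additive_phi_right: "additive (phi t)"
  using psh_map_in_End_Z[OF additive_comult inner_biadditive] by (simp add: End_Z_def)

text \<open>The product rule moves \<open>skew y\<close> past multiplication by \<open>x'\<close>,
  leaving terms \<open>x * skew a x' * skew b (skew y' z)\<close>; the last two operators merge into
  \<open>skew (y' * b)\<close>.\<close>

lemma phi_compose_tens:
  "phi (tens x y) (phi (tens x' y') z) =
     phi (tensor_lift (\<lambda>a b. tens (x * skew a x') (y' * b)) (\<Delta> y)) z"
proof -
  have b1: "biadditive (\<lambda>a b. skew a x' * skew (y' * b) z)"
    by (rule biadditiveI) (simp_all add: skew_add_left algebra_simps)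
  have b2: "biadditive (\<lambda>a b. tens (x * skew a x') (y' * b))"
    by (rule biadditiveI)
      (simp_all add: skew_add_left distrib_left biadditive_add[OF biadditive_tens])
  have x: "additive ((*) x)" by (simp add: additive_def distrib_left)
  show ?thesis
    by (simp add: phi_tens skew_mult additive_tensor_lift_commute[OF x b1]
        additive_tensor_lift_commute[OF additive_phi b2] skew_skew mult.assoc)
qed

text \<open>Witnesses for pure tensors add up, first in \<open>u\<close>, then in \<open>t\<close>.
  The witness is chosen before \<open>z\<close>, so it gives an equality of endomorphisms.\<close>

lemma phi_compose: "\<exists>v. \<forall>z. phi t (phi u z) = phi v z"
proof -
  interpret l: additive "\<lambda>t. phi t z" for z by (rule additive_phi)
  interpret r: additive "phi v" for v by (rule additive_phi_right)
  have pure: "\<exists>v. \<forall>z. phi (tens x y) (phi u z) = phi v z" for x y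
  proof (induction u rule: tensor_induct)
    case (tens x' y')
    show ?case using phi_compose_tens by blast
  next
    case (add t u)
    then show ?case by (metis l.add r.add)
  next
    case (minus t)
    then show ?case by (metis l.minus r.minus)
  qed
  show ?thesis
  proof (induction t rule: tensor_induct)
    case (tens x y)
    show ?case by (rule pure)
  next
    case (add t t')
    then show ?case by (metis l.add)
  next
    case (minus t)
    then show ?case by (metis l.minus)
  qed
qed

lemma subring_range_phi: "subring (range phi) (End_Z :: ('a \<Rightarrow> 'a) ring)"
proof -
  interpret E: ring "End_Z :: ('a \<Rightarrow> 'a) ring" by (rule ring_End_Z)
  interpret l: additive "\<lambda>t. phi t z" for z by (rule additive_phi)
  show ?thesis
  proof (rule E.subringI)
    show sub: "range phi \<subseteq> carrier End_Z"
      using psh_map_in_End_Z[OF additive_comult inner_biadditive] by blast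
    have "phi (tens 1 1) = id" by (simp add: fun_eq_iff phi_tens skew_1)
    then have "\<one>\<^bsub>End_Z\<^esub> = phi (tens 1 1)" by (simp add: End_Z_def)
    then show "\<one>\<^bsub>End_Z\<^esub> \<in> range phi" by simp
    show "\<ominus>\<^bsub>End_Z\<^esub> f \<in> range phi" if f: "f \<in> range phi" for f
    proof -
      obtain t where t: "f = phi t" using f by (rule rangeE)
      have "phi (- t) \<oplus>\<^bsub>End_Z\<^esub> f = \<zero>\<^bsub>End_Z\<^esub>" by (simp add: t End_Z_def l.minus)
      then have "\<ominus>\<^bsub>End_Z\<^esub> f = phi (- t)" using sub f by (intro E.minus_equality) auto
      then show ?thesis by simp
    qed
    show "f \<otimes>\<^bsub>End_Z\<^esub> g \<in> range phi" if fg: "f \<in> range phi" "g \<in> range phi" for f g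
    proof -
      obtain t where t: "f = phi t" using fg(1) by (rule rangeE)
      obtain u where u: "g = phi u" using fg(2) by (rule rangeE)
      obtain v where "\<forall>z. phi t (phi u z) = phi v z" using phi_compose by blast
      then have "f \<otimes>\<^bsub>End_Z\<^esub> g = phi v" by (simp add: t u End_Z_def fun_eq_iff)
      then show ?thesis by simp
    qed
    show "f \<oplus>\<^bsub>End_Z\<^esub> g \<in> range phi" if fg: "f \<in> range phi" "g \<in> range phi" for f g
    proof -
      obtain t where t: "f = phi t" using fg(1) by (rule rangeE)
      obtain u where u: "g = phi u" using fg(2) by (rule rangeE)
      show ?thesis
        unfolding t u additive_psh_map[OF additive_comult inner_biadditive, symmetric] by (rule rangeI)
    qed
  qed
qed

section \<open>Degrees and connectedness\<close>

text \<open>Orthogonality is assumed for basis elements only; it carries over because a homogeneous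
  element involves only basis elements of its own degree.\<close>

lemma ip_degree:
  assumes "x \<in> G i" "y \<in> G j" "i \<noteq> j"
  shows "ip x y = 0"
proof -
  obtain d where d: "b \<in> G (d b)" if "b \<in> \<Omega>" for b
    using basis_homogeneous by (metis UN_E subsetD)
  have ex: "\<exists>U c. finite U \<and> U \<subseteq> \<Omega> \<inter> {b. d b = n} \<and> x = (\<Sum>b\<in>U. zscale (c b) b)"
    if x: "x \<in> G n" for x n
  proof -
    obtain T c where T: "finite T" "T \<subseteq> \<Omega>" "x = (\<Sum>b\<in>T. zscale (c b) b)"
      by (rule is_Z_basis_exE[OF basis])
    have "x = (\<Sum>b | b \<in> T \<and> d b = n. zscale (c b) b)"
      by (rule is_grading_component[OF grading x T(1,3)])
        (use T(2) d is_grading_zscale_closed[OF grading] in blast)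
    with T(1,2) show ?thesis
      by (intro exI[where x = "{b \<in> T. d b = n}"] exI[where x = c]) auto
  qed
  obtain U c V e where *: "U \<subseteq> \<Omega> \<inter> {b. d b = i}" "x = (\<Sum>b\<in>U. zscale (c b) b)"
    "V \<subseteq> \<Omega> \<inter> {b. d b = j}" "y = (\<Sum>b\<in>V. zscale (e b) b)"
    using ex[OF assms(1)] ex[OF assms(2)] by blast
  \<comment> \<open>\<open>U\<close> and \<open>V\<close> are disjoint, since \<open>d\<close> is
    \<open>i\<close> on one and \<open>j\<close> on the other.\<close>
  have "ip b b' = 0" if "b \<in> U" "b' \<in> V" for b b'
    using that * assms(3) by (intro basis_orthogonal) auto
  then show ?thesis
    unfolding *(2,4) additive_sum_eq[OF ip_additive(1)] additive_sum_eq[OF ip_additive(2)]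
    by (simp add: ip_zscale)
qed

lemma counit_of_int: "\<epsilon> (of_int k) = k"
  using additive_zscale[OF additive_counit, of k 1] by (simp add: zscale_eq_of_int_mult counit_one)

text \<open>On \<open>tens x y\<close> with degrees \<open>i + j = n \<le> m\<close>, the pairing
  with \<open>b\<close> vanishes unless \<open>i = m\<close>, which forces \<open>j = 0\<close>;
  then \<open>y\<close> is an integer by connectedness. The counit appears so that
  \<open>counit_right\<close> applies when \<open>t\<close> is \<open>\<Delta> z\<close>.\<close>

lemma contract_degree:
  assumes "b \<in> G m" "n \<le> m" "t \<in> tensor_degree G n"
  shows "contract b t = of_int (ip b (tensor_lift (\<lambda>x y. zscale (\<epsilon> y) x) t))"
proof -
  interpret c: additive "contract b" by (rule additive_contract)
  interpret e: additive \<epsilon> by (rule additive_counit)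
  have be: "biadditive (\<lambda>x y. zscale (\<epsilon> y) (x::'a))"
    by (rule biadditiveI) (simp_all add: e.add zscale_add_left zscale_add_right)
  interpret r: additive "tensor_lift (\<lambda>x y. zscale (\<epsilon> y) (x::'a))"
    by (rule additive_tensor_lift[OF be])
  interpret i: additive "ip b" by (rule ip_additive)
  from assms(3) show ?thesis
    unfolding tensor_degree_def
  proof (induction rule: group_closure.induct)
    \<comment> \<open>The base elements of a group closure are the generators together with
      0.\<close>
    case (base s)
    then consider "s = 0"
      | x y i j where "s = tens x y" "i + j = n" "x \<in> G i" "y \<in> G j" by blast
    then show ?case
    proof cases
      case 1
      then show ?thesis by (simp add: c.zero r.zero)
    next
      case s: 2
      show ?thesis
      proof (cases "j = 0")
        case True
        then obtain k where k: "y = of_int k"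
          using s(4) unit_iso by (auto simp: bij_betw_def)
        then show ?thesis
          unfolding s(1) k tensor_lift_tens[OF be] contract_tens counit_of_int ip_zscale
          by (simp add: zscale_eq_of_int_mult mult.commute flip: of_int_mult)
      next
        case False
        then have "ip b x = 0" using ip_degree[OF assms(1) s(3)] s(2) assms(2) by simp
        then show ?thesis by (simp add: s(1) tensor_lift_tens[OF be] ip_zscale)
      qed
   qed
  next
    case (diff s t)
    then show ?case by (simp add: c.diff r.diff i.diff)
  qed
qed

text \<open>For \<open>n < m\<close> both sides vanish; the case \<open>n = m\<close> supplies the
  diagonal terms for injectivity.\<close>

lemma skew_degree:
  assumes "b \<in> G m" "z \<in> G n" "n \<le> m"
  shows "skew b z = of_int (ip b z)"
  using contract_degree[OF assms(1,3) comult_degree[OF assms(2)]]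
  by (simp add: skew_eq counit_right)

section \<open>Injectivity\<close>

lemma phi_kernel:
  assumes "\<And>z. phi t z = 0"
  shows "t = 0"
proof -
  obtain T f where T: "finite T" "T \<subseteq> \<Omega>" "t = (\<Sum>b\<in>T. tens (f b) b)"
    using tensor_basis_expansion[OF basis] by blast
  obtain d where d: "b \<in> G (d b)" if "b \<in> \<Omega>" for b
    using basis_homogeneous by (metis UN_E subsetD)
  have "f b = 0" if "b \<in> T" for b
    using that
  proof (induction "d b" arbitrary: b rule: less_induct)
    case less
    \<comment> \<open>Evaluation at the basis elements themselves gives a system triangular in the
      degree, with diagonal entries \<open>ip b b\<close>.\<close>
    have "0 = (\<Sum>c\<in>T. f c * skew c b)"
      using assms[of b] by (simp add: T(3) additive_sum_eq[OF additive_phi] phi_tens)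
    also have "\<dots> = (\<Sum>c\<in>T. if c = b then zscale (ip b b) (f b) else 0)"
    proof (rule sum.cong)
      fix c assume c: "c \<in> T"
      then have "c \<in> \<Omega>" "b \<in> \<Omega>" using less.prems T(2) by auto
      show "f c * skew c b = (if c = b then zscale (ip b b) (f b) else 0)"
      proof (cases "d c < d b")
        case True
        then show ?thesis using less.hyps[OF True c] by auto
      next
        case False
        \<comment> \<open>This includes the other basis elements of the same degree as
          \<open>b\<close>, which orthogonality then removes.\<close>
        then have "skew c b = of_int (ip c b)"
          using \<open>c \<in> \<Omega>\<close> \<open>b \<in> \<Omega>\<close> by (intro skew_degree[OF d d]) auto
        then show ?thesis
          using \<open>c \<in> \<Omega>\<close> \<open>b \<in> \<Omega>\<close> basis_orthogonal[of c b]
          by (auto simp: zscale_eq_of_int_mult mult_of_int_commute)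
      qed
    qed simp
    also have "\<dots> = zscale (ip b b) (f b)" using T(1) less.prems by simp
    finally have "ip b b = 0 \<or> f b = 0" by (metis zscale_eq_0_iff)
    moreover have "b \<noteq> 0" using is_Z_basis_nonzero[OF basis] less.prems T(2) by blast
    ultimately show ?case using inner_pos[of b] by auto
  qed
  moreover have "tens 0 b = (0 :: ('a, 'a) tensor)" for b
    using biadditive_add(1)[OF biadditive_tens, of 0 0 b] by simp
  ultimately show ?thesis by (simp add: T(3))
qed

lemma inj_phi: "inj phi"
proof (rule injI)
  fix t u assume eq: "phi t = phi u"
  interpret l: additive "\<lambda>t. phi t z" for z by (rule additive_phi)
  have "t - u = 0" by (rule phi_kernel) (simp add: l.diff eq)
  then show "t = u" by simp
qed

end

theorem proposition5p4:
  fixes \<Delta> :: "'a::ring_1 \<Rightarrow> ('a, 'a) tensor"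
    and \<epsilon> :: "'a \<Rightarrow> int"
    and S :: "'a \<Rightarrow> 'a"
    and G :: "nat \<Rightarrow> 'a set"
    and ip :: "'a \<Rightarrow> 'a \<Rightarrow> int"
    and \<Omega> :: "'a set"
  assumes "psh_algebra \<Delta> \<epsilon> S G ip \<Omega>"
  shows "inj (psh_map \<Delta> ip) \<and> subring (range (psh_map \<Delta> ip)) (End_Z :: ('a \<Rightarrow> 'a) ring)"
proof -
  interpret psh_algebra \<Delta> \<epsilon> S G ip \<Omega> by fact
  show ?thesis using inj_phi subring_range_phi by blast
qed

end
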